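(* Let $\alpha>0$ be real and let $n,m$ be nonnegative integers. Then for all $z\in\mathbb{C}\setminus[0,1]$, $$ \begin{aligned} (1-z)^{-n-1}(1-z^{-1})^{-\alpha}\,{}_2F_1(m+1,-\alpha;\,n+m+2;\,z^{-1}) ={}&\frac{(n+1)_{m+1}}{(n+\alpha+1)_{m+1}}\,z^{m+1}(1-z)^{-n-1}(1-z^{-1})^{-\alpha}\,{}_2F_1(-n,m+1;\,-n-\alpha;\,1-z)\\ &+\frac{(m+1)_{n+1}}{(m+\alpha+1)_{n+1}}\,{}_2F_1(-m,n+1;\,-m-\alpha;\,z). \end{aligned} $$
   Context: $(a)_k$ is the Pochhammer symbol: $(a)_0=1$ and $(a)_k=a(a+1)\cdots(a+k-1)$ for $k\ge1$. The Gauss hypergeometric function is ${}_2F_1(a,b;c;w)=\sum_{k=0}^\infty\frac{(a)_k(b)_k}{(c)_k\,k!}w^k$ for $|w|<1$, $c\notin\{0,-1,-2,\ldots\}$, and it denotes also the unique analytic continuation of this power series to $w\in\mathbb{C}\setminus[1,\infty)$. In the terminating case, for a nonnegative integer $N$, ${}_2F_1(-N,b;c;w)=\sum_{k=0}^N\frac{(-N)_k(b)_k}{(c)_k\,k!}w^k$ is a polynomial in $w$, defined for all $w\in\mathbb{C}$ whenever $c\notin\{0,-1,\ldots,-N+1\}$. The power $(1-z^{-1})^{-\alpha}$ is the principal branch, which is well defined for $z\notin[0,1]$ (where $1-z^{-1}\notin(-\infty,0]$). *)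

theory Defs
  imports "HOL-Complex_Analysis.Complex_Analysis"
begin

definition hyp2F1_series :: "complex \<Rightarrow> complex \<Rightarrow> complex \<Rightarrow> complex \<Rightarrow> complex" where
  "hyp2F1_series a b c w =
     (\<Sum>k. pochhammer a k * pochhammer b k / (pochhammer c k * fact k) * w ^ k)"

definition slit_plane :: "complex set" where
  "slit_plane = - (complex_of_real ` {1..})"

definition hyp2F1_continuation ::
    "complex \<Rightarrow> complex \<Rightarrow> complex \<Rightarrow> (complex \<Rightarrow> complex) \<Rightarrow> bool" where
  "hyp2F1_continuation a b c f \<longleftrightarrow>
     f holomorphic_on slit_plane \<and> (\<forall>w. norm w < 1 \<longrightarrow> f w = hyp2F1_series a b c w)"

text \<open>
  The Gauss hypergeometric function as the value of the analytic continuation of its power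
  series. Meaningful for \<open>c \<notin> \<int>\<^sub>\<le>\<^sub>0\<close> and \<open>w \<in> slit_plane\<close>. The description ranges over values
  rather than functions because the continuation is only determined on \<open>slit_plane\<close>.
\<close>
definition hyp2F1 :: "complex \<Rightarrow> complex \<Rightarrow> complex \<Rightarrow> complex \<Rightarrow> complex" where
  "hyp2F1 a b c w = (THE y. \<exists>f. hyp2F1_continuation a b c f \<and> y = f w)"

text \<open>
  The terminating case, with first parameter \<open>-N\<close>. It is kept separate from \<open>hyp2F1\<close> because the
  polynomial is defined on the whole plane, and also for negative integers \<open>c \<le> -N\<close>.
\<close>
definition hyp2F1_term :: "nat \<Rightarrow> complex \<Rightarrow> complex \<Rightarrow> complex \<Rightarrow> complex" where
  "hyp2F1_term N b c w =
     (\<Sum>k\<le>N. pochhammer (- of_nat N) k * pochhammer b k / (pochhammer c k * fact k) * w ^ k)"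

lemma open_slit_plane: "open slit_plane"
proof -
  have "closed (complex_of_real ` {1..})"
    by (intro closed_injective_linear_image)
       (auto simp: inj_on_def bounded_linear.linear[OF bounded_linear_of_real])
  then show ?thesis by (simp add: slit_plane_def open_Compl)
qed

lemma starlike_slit_plane: "starlike slit_plane"
  unfolding starlike_def
proof (intro bexI ballI subsetI)
  show "0 \<in> slit_plane" by (auto simp: slit_plane_def)
next
  fix x y assume x: "x \<in> slit_plane" and "y \<in> closed_segment 0 x"
  then obtain u where u: "0 \<le> u" "u \<le> 1" "y = of_real u * x"
    by (auto simp: closed_segment_def scaleR_conv_of_real)
  show "y \<in> slit_plane"
  proof (rule ccontr)
    assume "y \<notin> slit_plane"
    then obtain r where r: "r \<ge> 1" "y = of_real r" by (auto simp: slit_plane_def)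
    have "u \<noteq> 0" using r u by auto
    then have "x = of_real (r / u)" using r u by (simp add: field_simps)
    moreover have "r / u \<ge> 1" using r u \<open>u \<noteq> 0\<close> by (simp add: field_simps)
    ultimately have "x \<in> complex_of_real ` {1..}" by (intro image_eqI[where x = "r / u"]) auto
    then show False using x by (simp add: slit_plane_def)
  qed
qed

lemma ball_subset_slit_plane: "ball 0 1 \<subseteq> slit_plane"
  by (auto simp: slit_plane_def)

lemma hyp2F1_continuation_unique:
  assumes f: "hyp2F1_continuation a b c f" and g: "hyp2F1_continuation a b c g"
    and w: "w \<in> slit_plane"
  shows "f w = g w"
proof -
  have "f w - g w = 0"
  proof (rule analytic_continuation_open[where s = "ball 0 1" and s' = slit_plane
        and f = "\<lambda>w. f w - g w" and g = "\<lambda>w. 0"])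
    show "connected slit_plane"
      by (rule starlike_imp_connected[OF starlike_slit_plane])
  qed (use assms ball_subset_slit_plane open_slit_plane in
        \<open>auto simp: hyp2F1_continuation_def intro!: holomorphic_intros\<close>)
  then show ?thesis by simp
qed

lemma hyp2F1_eq_continuation:
  assumes "hyp2F1_continuation a b c f" and "w \<in> slit_plane"
  shows "hyp2F1 a b c w = f w"
  unfolding hyp2F1_def
  using assms hyp2F1_continuation_unique by (intro the_equality) blast+

end

theory Submission
  imports Defs
begin

text \<open>
  Put \<open>w = inverse z\<close>. Without the prefactor \<open>(1 - z) powi (- n - 1) * (1 - w) powr (- \<alpha>)\<close>, and up to the
  constant \<open>Beta (m + 1) (n + 1)\<close> and the power \<open>w ^ (n + m + 1)\<close>, both sides of the identity are
  evaluations of one integral. For \<open>0 < w < 1\<close> let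
  \<open>h t = t ^ m * (w - t) ^ n * (1 - t) powr \<alpha>\<close>. Then

  \<^item> over \<open>[0, w]\<close>, the substitution \<open>t = w * s\<close> turns the integral of \<open>h\<close> into \<open>w ^ (n + m + 1)\<close>
    times Euler's integral, which the binomial series evaluates to the non-terminating
    hypergeometric series at \<open>w\<close> (\<open>Euler_integral_lower\<close>);
  \<^item> over \<open>[0, 1]\<close>, expanding \<open>w - t = (w - 1) * t + w * (1 - t)\<close> by the binomial theorem gives a
    finite sum of beta integrals, the first terminating series (\<open>Euler_integral_whole\<close>);
  \<^item> over \<open>[w, 1]\<close>, the substitution \<open>t = w + (1 - w) * s\<close> makes \<open>w - t\<close> and \<open>1 - t\<close> monomials, and
    expanding \<open>t = s + w * (1 - s)\<close> gives the second one (\<open>Euler_integral_upper\<close>).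

  The theorem is the relation "lower part = whole - upper part". The splittings of \<open>w - t\<close> and \<open>t\<close> are
  chosen so that each term is a single beta value, and \<open>binomial_times_Beta\<close> identifies these with the
  hypergeometric coefficients for both finite sums, the second being the first with \<open>m\<close> and \<open>n\<close>
  exchanged.

  The finite side, \<open>closed_form\<close>, is holomorphic on the whole slit plane. By the identity theorem
  the relation extends from \<open>(0, 1)\<close> to the unit disc, and \<open>closed_form \<alpha> m n w / w ^ (n + m + 1)\<close>,
  patched at \<open>0\<close> by the series, is therefore the analytic continuation that defines \<open>hyp2F1\<close>
  (\<open>hyp2F1_eq_closed_form\<close>). What remains is the change of variable back to \<open>z\<close>.
\<close>

section \<open>Beta values as hypergeometric coefficients\<close>

lemma Beta_shift_both:
  fixes a b :: real
  assumes "a > 0" "b > 0"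
  shows "Beta (a + of_nat k) b = Beta a (b + of_nat k) * pochhammer a k / pochhammer b k"
proof -
  have "a \<notin> \<int>\<^sub>\<le>\<^sub>0" "b \<notin> \<int>\<^sub>\<le>\<^sub>0" using assms by (auto elim!: nonpos_Ints_cases)
  then have "pochhammer a k = Gamma (a + of_nat k) / Gamma a"
    and "pochhammer b k = Gamma (b + of_nat k) / Gamma b"
    by (simp_all add: pochhammer_Gamma)
  moreover have "Gamma a > 0" "Gamma b > 0" "Gamma (b + of_nat k) > 0"
    using assms by (auto intro!: Gamma_real_pos)
  ultimately show ?thesis by (simp add: Beta_def add_ac)
qed

lemma Beta_shift_first:
  fixes a b :: real
  assumes "a > 0" "b > 0"
  shows "Beta (a + of_nat k) b = Beta a b * pochhammer a k / pochhammer (a + b) k"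
proof -
  have "a \<notin> \<int>\<^sub>\<le>\<^sub>0" "a + b \<notin> \<int>\<^sub>\<le>\<^sub>0" using assms by (auto elim!: nonpos_Ints_cases)
  then have "pochhammer a k = Gamma (a + of_nat k) / Gamma a"
    and "pochhammer (a + b) k = Gamma (a + b + of_nat k) / Gamma (a + b)"
    by (simp_all add: pochhammer_Gamma)
  moreover have "Gamma a > 0" "Gamma (a + b) > 0" "Gamma (a + b + of_nat k) > 0"
    using assms by (auto intro!: Gamma_real_pos)
  ultimately show ?thesis by (simp add: Beta_def field_simps)
qed

lemma Beta_nat_left:
  fixes b :: real
  assumes "b > 0"
  shows "Beta (of_nat m + 1) b = fact m / pochhammer b (m + 1)"
proof -
  have "b \<notin> \<int>\<^sub>\<le>\<^sub>0" using assms by (auto elim!: nonpos_Ints_cases)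
  then have "pochhammer b (m + 1) = Gamma (b + of_nat (m + 1)) / Gamma b"
    by (rule pochhammer_Gamma)
  moreover have "Gamma (of_nat m + 1 :: real) = fact m"
    using Gamma_fact[of m, where 'a = real] by (simp add: add.commute)
  ultimately show ?thesis by (simp add: Beta_def algebra_simps)
qed

text \<open>
  The bridge between the beta integrals and the terminating series: moving \<open>i\<close> units from the
  second argument of the beta function to the first yields \<open>(m + 1)\<^sub>i\<close> over a Pochhammer symbol in
  \<open>n - i + \<alpha> + 1\<close>, and reversing the order of factors in the latter, as in the binomial
  coefficient, produces the parameters \<open>-n - \<alpha>\<close> and \<open>-n\<close> with cancelling signs.
\<close>
lemma binomial_times_Beta:
  fixes \<alpha> :: real
  assumes "\<alpha> > 0" "i \<le> n"
  shows "of_nat (n choose i) * Beta (of_nat (m + i) + 1) (of_nat (n - i) + \<alpha> + 1) =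
    Beta (of_nat m + 1) (of_nat n + 1) *
      (pochhammer (of_nat n + 1) (m + 1) / pochhammer (of_nat n + \<alpha> + 1) (m + 1)) *
      (pochhammer (- of_nat n) i * pochhammer (of_nat m + 1) i /
        (pochhammer (- of_nat n - \<alpha>) i * fact i))"
proof -
  have "Beta (of_nat (m + i) + 1) (of_nat (n - i) + \<alpha> + 1) =
      Beta ((of_nat m + 1) + of_nat i) (of_nat (n - i) + \<alpha> + 1)"
    by (simp add: algebra_simps)
  also have "\<dots> = Beta (of_nat m + 1) (of_nat (n - i) + \<alpha> + 1 + of_nat i) *
      pochhammer (of_nat m + 1) i / pochhammer (of_nat (n - i) + \<alpha> + 1) i"
    using assms by (intro Beta_shift_both) auto
  also have "of_nat (n - i) + \<alpha> + 1 + of_nat i = of_nat n + \<alpha> + 1"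
    using assms by (simp add: of_nat_diff)
  finally have 1: "Beta (of_nat (m + i) + 1) (of_nat (n - i) + \<alpha> + 1) =
      Beta (of_nat m + 1) (of_nat n + \<alpha> + 1) *
      pochhammer (of_nat m + 1) i / pochhammer (of_nat (n - i) + \<alpha> + 1) i" .
  have "pochhammer (- (of_nat n + \<alpha>)) i = (-1) ^ i * pochhammer (of_nat n + \<alpha> - of_nat i + 1) i"
    by (rule pochhammer_minus)
  moreover have "- (of_nat n + \<alpha>) = - of_nat n - \<alpha>"
    and "of_nat n + \<alpha> - of_nat i + 1 = of_nat (n - i) + \<alpha> + 1"
    using assms by (simp_all add: of_nat_diff)
  ultimately have 2: "pochhammer (- of_nat n - \<alpha>) i = (-1) ^ i * pochhammer (of_nat (n - i) + \<alpha> + 1) i"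
    by (simp only:)
  have 3: "real (n choose i) = (-1) ^ i * pochhammer (- of_nat n) i / fact i"
    by (simp add: binomial_gbinomial gbinomial_pochhammer)
  have pos: "pochhammer (real n + 1) (m + 1) > 0" "pochhammer (real n + \<alpha> + 1) (m + 1) > 0"
    "pochhammer (real (n - i) + \<alpha> + 1) i > 0"
    using assms by (auto intro!: pochhammer_pos)
  have 4: "Beta (real m + 1) (real n + \<alpha> + 1) = Beta (of_nat m + 1) (of_nat n + 1) *
      (pochhammer (of_nat n + 1) (m + 1) / pochhammer (of_nat n + \<alpha> + 1) (m + 1))"
    using pos assms by (simp add: Beta_nat_left del: pochhammer_Suc)
  have sgn: "((-1::real) ^ i) * ((-1) ^ i) = 1"
    by (simp flip: power_add)
  have "(-1) ^ i * P / F * (B * M / D) = B * (P * M / ((-1) ^ i * D * F))" for P F B M D :: real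
    using sgn by (cases "even i") (auto simp: mult_ac)
  then show ?thesis unfolding 1 2 3 4 .
qed

section \<open>The Euler integral and its two finite pieces\<close>

text \<open>
  Only the end points distinguish this from the usual beta integral: \<open>0 powr 0 = 0\<close> whereas
  \<open>0 ^ 0 = 1\<close>.
\<close>
lemma Beta_integral_power:
  fixes \<alpha> :: real
  assumes "\<alpha> \<ge> 0"
  shows "((\<lambda>t. t ^ a * (1 - t) ^ b * (1 - t) powr \<alpha>) has_integral
           Beta (of_nat a + 1) (of_nat b + \<alpha> + 1)) {0..1}"
proof (rule has_integral_spike_finite)
  show "((\<lambda>t. t powr (of_nat a + 1 - 1) * (1 - t) powr (of_nat b + \<alpha> + 1 - 1)) has_integral
      Beta (of_nat a + 1) (of_nat b + \<alpha> + 1)) {0..1}"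
    using assms by (intro has_integral_Beta_real) auto
  show "t ^ a * (1 - t) ^ b * (1 - t) powr \<alpha> =
      t powr (of_nat a + 1 - 1) * (1 - t) powr (of_nat b + \<alpha> + 1 - 1)"
    if "t \<in> {0..1} - {0, 1}" for t
    using that by (auto simp: powr_realpow powr_add)
qed auto

lemma has_integral_rescale_unit_interval:
  fixes f :: "real \<Rightarrow> real"
  assumes "((\<lambda>s. f (a + (b - a) * s)) has_integral I) {0..1}" "a < b"
  shows "(f has_integral (b - a) * I) {a..b}"
proof -
  have "((\<lambda>x. f (a + (b - a) * (inverse (b - a) *\<^sub>R x + (- a / (b - a))))) has_integral
       (1 / \<bar>inverse (b - a)\<bar> ^ DIM(real)) *\<^sub>R I)
       ((\<lambda>x. (1 / inverse (b - a)) *\<^sub>R x + - ((1 / inverse (b - a)) *\<^sub>R (- a / (b - a)))) ` cbox 0 1)"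
    using assms by (intro has_integral_affinity) auto
  also have "(\<lambda>x. (1 / inverse (b - a)) *\<^sub>R x + - ((1 / inverse (b - a)) *\<^sub>R (- a / (b - a)))) ` cbox 0 1
      = {a..b}"
  proof -
    have "(\<lambda>x. (1 / inverse (b - a)) *\<^sub>R x + - ((1 / inverse (b - a)) *\<^sub>R (- a / (b - a)))) =
        (\<lambda>x. (b - a) * x + a)"
      using assms(2) by (simp add: fun_eq_iff divide_inverse)
    then show ?thesis
      using assms(2) image_affinity_atLeastAtMost[of "b - a" a 0 1]
      by (simp only: cbox_interval) simp
  qed
  also have "(\<lambda>x. f (a + (b - a) * (inverse (b - a) *\<^sub>R x + (- a / (b - a))))) = f"
  proof (intro ext arg_cong[where f = f])
    fix x
    have "(b - a) * (inverse (b - a) *\<^sub>R x + (- a / (b - a))) =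
        (b - a) * inverse (b - a) * x + (b - a) * (- a / (b - a))"
      by (simp only: distrib_left real_scaleR_def mult.assoc)
    also have "\<dots> = x - a" using assms(2) by simp
    finally show "a + (b - a) * (inverse (b - a) *\<^sub>R x + (- a / (b - a))) = x" by simp
  qed
  finally show ?thesis using assms(2) by (simp add: field_simps)
qed

lemma Euler_integral_whole:
  fixes \<alpha> w :: real
  assumes "\<alpha> > 0"
  shows "((\<lambda>t. t ^ m * (w - t) ^ n * (1 - t) powr \<alpha>) has_integral
      (\<Sum>i\<le>n. of_nat (n choose i) * Beta (of_nat (m + i) + 1) (of_nat (n - i) + \<alpha> + 1) *
         (w ^ (n - i) * (w - 1) ^ i))) {0..1}"
proof (rule has_integral_eq)
  show "((\<lambda>t. \<Sum>i\<le>n. of_nat (n choose i) * (w ^ (n - i) * (w - 1) ^ i) *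
          (t ^ (m + i) * (1 - t) ^ (n - i) * (1 - t) powr \<alpha>)) has_integral
      (\<Sum>i\<le>n. of_nat (n choose i) * Beta (of_nat (m + i) + 1) (of_nat (n - i) + \<alpha> + 1) *
         (w ^ (n - i) * (w - 1) ^ i))) {0..1}"
  proof (rule has_integral_sum)
    fix i
    show "((\<lambda>t. of_nat (n choose i) * (w ^ (n - i) * (w - 1) ^ i) *
          (t ^ (m + i) * (1 - t) ^ (n - i) * (1 - t) powr \<alpha>)) has_integral
      of_nat (n choose i) * Beta (of_nat (m + i) + 1) (of_nat (n - i) + \<alpha> + 1) *
         (w ^ (n - i) * (w - 1) ^ i)) {0..1}"
      using has_integral_mult_right[OF Beta_integral_power[of \<alpha> "m + i" "n - i"],
          of "of_nat (n choose i) * (w ^ (n - i) * (w - 1) ^ i)"] assms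
      by (simp add: mult_ac)
  qed auto
  \<comment> \<open>A combination of \<open>t\<close> and \<open>1 - t\<close>, the two factors already in the integrand, so that every term
    is again a beta integrand.\<close>
  fix t :: real
  have "w - t = (w - 1) * t + w * (1 - t)" by (simp add: algebra_simps)
  then have "(w - t) ^ n = (\<Sum>i\<le>n. of_nat (n choose i) * ((w - 1) * t) ^ i * (w * (1 - t)) ^ (n - i))"
    by (simp only: binomial_ring)
  then show "(\<Sum>i\<le>n. of_nat (n choose i) * (w ^ (n - i) * (w - 1) ^ i) *
          (t ^ (m + i) * (1 - t) ^ (n - i) * (1 - t) powr \<alpha>)) = t ^ m * (w - t) ^ n * (1 - t) powr \<alpha>"
    by (simp add: sum_distrib_left sum_distrib_right power_mult_distrib power_add mult_ac)
qed

text \<open>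
  The substitution \<open>t = w + (1 - w) * s\<close> exchanges the roles of the factors: now \<open>w - t\<close> is a
  multiple of \<open>s\<close>, and \<open>t = s + w * (1 - s)\<close> has to be expanded. The constant \<open>C\<close> in the proof
  collects the powers of \<open>1 - w\<close> split off from \<open>w - t\<close> and \<open>1 - t\<close>; one more comes from \<open>dt\<close>.
\<close>
lemma Euler_integral_upper:
  fixes \<alpha> w :: real
  assumes "\<alpha> > 0" "w < 1"
  shows "((\<lambda>t. t ^ m * (w - t) ^ n * (1 - t) powr \<alpha>) has_integral
      (-1) ^ n * (1 - w) ^ (n + 1) * (1 - w) powr \<alpha> *
      (\<Sum>j\<le>m. of_nat (m choose j) * Beta (of_nat (n + j) + 1) (of_nat (m - j) + \<alpha> + 1) *
         w ^ (m - j))) {w..1}"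
proof -
  define C where "C = (-1) ^ n * (1 - w) ^ n * (1 - w) powr \<alpha>"
  let ?S = "\<Sum>j\<le>m. of_nat (m choose j) * Beta (of_nat (n + j) + 1) (of_nat (m - j) + \<alpha> + 1) *
         w ^ (m - j)"
  have "((\<lambda>s. \<Sum>j\<le>m. of_nat (m choose j) * w ^ (m - j) *
          (s ^ (n + j) * (1 - s) ^ (m - j) * (1 - s) powr \<alpha>)) has_integral ?S) {0..1}"
  proof (rule has_integral_sum)
    fix j
    show "((\<lambda>s. of_nat (m choose j) * w ^ (m - j) *
          (s ^ (n + j) * (1 - s) ^ (m - j) * (1 - s) powr \<alpha>)) has_integral
      of_nat (m choose j) * Beta (of_nat (n + j) + 1) (of_nat (m - j) + \<alpha> + 1) *
         w ^ (m - j)) {0..1}"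
      using has_integral_mult_right[OF Beta_integral_power[of \<alpha> "n + j" "m - j"],
          of "of_nat (m choose j) * w ^ (m - j)"] assms
      by (simp add: mult_ac)
  qed auto
  then have "((\<lambda>s. C * (\<Sum>j\<le>m. of_nat (m choose j) * w ^ (m - j) *
          (s ^ (n + j) * (1 - s) ^ (m - j) * (1 - s) powr \<alpha>))) has_integral C * ?S) {0..1}"
    by (rule has_integral_mult_right)
  then have "((\<lambda>s. (w + (1 - w) * s) ^ m * (w - (w + (1 - w) * s)) ^ n *
      (1 - (w + (1 - w) * s)) powr \<alpha>) has_integral C * ?S) {0..1}"
  proof (rule has_integral_eq[rotated])
    fix s :: real assume s: "s \<in> {0..1}"
    have "w + (1 - w) * s = s + w * (1 - s)" by (simp add: algebra_simps)
    then have 1: "(w + (1 - w) * s) ^ m =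
        (\<Sum>j\<le>m. of_nat (m choose j) * s ^ j * (w * (1 - s)) ^ (m - j))"
      by (simp only: binomial_ring)
    have "w - (w + (1 - w) * s) = - 1 * (1 - w) * s" by (simp add: algebra_simps)
    then have 2: "(w - (w + (1 - w) * s)) ^ n = (-1) ^ n * (1 - w) ^ n * s ^ n"
      by (simp only: power_mult_distrib)
    have "1 - (w + (1 - w) * s) = (1 - w) * (1 - s)" by (simp add: algebra_simps)
    then have 3: "(1 - (w + (1 - w) * s)) powr \<alpha> = (1 - w) powr \<alpha> * (1 - s) powr \<alpha>"
      using s assms by (simp add: powr_mult)
    show "C * (\<Sum>j\<le>m. of_nat (m choose j) * w ^ (m - j) *
          (s ^ (n + j) * (1 - s) ^ (m - j) * (1 - s) powr \<alpha>)) =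
        (w + (1 - w) * s) ^ m * (w - (w + (1 - w) * s)) ^ n * (1 - (w + (1 - w) * s)) powr \<alpha>"
      unfolding 1 2 3 C_def
      by (simp add: sum_distrib_left sum_distrib_right power_mult_distrib power_add mult_ac)
  qed
  from has_integral_rescale_unit_interval[OF this assms(2)]
  show ?thesis by (simp add: C_def mult_ac)
qed

section \<open>Euler's integral as a hypergeometric series\<close>

lemma binomial_series_sums:
  fixes \<alpha> x :: real
  assumes "\<bar>x\<bar> < 1"
  shows "(\<lambda>k. pochhammer (- \<alpha>) k / fact k * x ^ k) sums (1 - x) powr \<alpha>"
proof -
  have "(\<lambda>k. (\<alpha> gchoose k) * (- x) ^ k) sums (1 + (- x)) powr \<alpha>"
    using assms by (intro gen_binomial_real) auto
  also have "(\<lambda>k. (\<alpha> gchoose k) * (- x) ^ k) = (\<lambda>k. pochhammer (- \<alpha>) k / fact k * x ^ k)"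
  proof
    fix k
    have "(-1::real) ^ k * (-1) ^ k = 1" by (simp flip: power_add)
    then show "(\<alpha> gchoose k) * (- x) ^ k = pochhammer (- \<alpha>) k / fact k * x ^ k"
      by (simp add: gbinomial_pochhammer power_minus[of x])
  qed
  finally show ?thesis by simp
qed

text \<open>
  This series serves twice as a majorant: for exchanging sum and integral in Euler's integral, and
  for the convergence of the hypergeometric series in the unit disc.
\<close>
lemma binomial_series_abs_summable:
  fixes \<alpha> x :: real
  assumes "0 \<le> x" "x < 1"
  shows "summable (\<lambda>k. \<bar>pochhammer (- \<alpha>) k / fact k\<bar> * x ^ k)"
proof -
  have "summable (\<lambda>k. pochhammer (- \<alpha>) k / fact k * ((1 + x) / 2) ^ k)"
    using assms by (intro sums_summable[OF binomial_series_sums]) auto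
  from powser_insidea[OF this, of x] show ?thesis
    using assms by (simp add: abs_mult power_abs)
qed

definition hyp2F1_coeff :: "real \<Rightarrow> nat \<Rightarrow> nat \<Rightarrow> nat \<Rightarrow> real" where
  "hyp2F1_coeff \<alpha> m n k =
    pochhammer (of_nat m + 1) k * pochhammer (- \<alpha>) k / (pochhammer (of_nat n + of_nat m + 2) k * fact k)"

text \<open>
  Expand \<open>(1 - w * s) powr \<alpha>\<close> by the binomial series and integrate term by term. Since \<open>w < 1\<close> is
  fixed, convergence is uniform in \<open>s\<close>, and the \<open>k\<close>-th term is the beta integral with first
  parameter \<open>m + k + 1\<close>.
\<close>
lemma Euler_integral_unit_sums:
  fixes \<alpha> w :: real
  assumes "0 < w" "w < 1" "\<alpha> > 0"
  shows "\<exists>S. (\<lambda>k. hyp2F1_coeff \<alpha> m n k * w ^ k) sums S \<and>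
    ((\<lambda>s. s ^ m * (1 - s) ^ n * (1 - w * s) powr \<alpha>) has_integral
       Beta (of_nat m + 1) (of_nat n + 1) * S) {0..1}"
proof -
  define u where "u k s = pochhammer (- \<alpha>) k / fact k * w ^ k * (s ^ (m + k) * (1 - s) ^ n)" for k and s :: real
  let ?B = "Beta (of_nat m + 1) (of_nat n + 1) :: real"
  have u_int: "(u k has_integral ?B * (hyp2F1_coeff \<alpha> m n k * w ^ k)) {0..1}" for k
  proof -
    have "((\<lambda>s. s ^ (m + k) * (1 - s) ^ n) has_integral Beta (of_nat (m + k) + 1) (of_nat n + 0 + 1)) {0..1::real}"
      by (rule has_integral_spike_finite[OF _ _ Beta_integral_power[where \<alpha> = 0], where S = "{1}"]) auto
    moreover have "Beta (of_nat (m + k) + 1) (of_nat n + 0 + 1) =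
        Beta ((of_nat m + 1) + of_nat k) (of_nat n + 1 :: real)" by (simp add: algebra_simps)
    ultimately have "((\<lambda>s. s ^ (m + k) * (1 - s) ^ n) has_integral
        ?B * pochhammer (of_nat m + 1) k / pochhammer (of_nat m + 1 + (of_nat n + 1)) k) {0..1::real}"
      by (simp add: Beta_shift_first)
    from has_integral_mult_right[OF this, of "pochhammer (- \<alpha>) k / fact k * w ^ k"]
    show ?thesis unfolding u_def hyp2F1_coeff_def by (simp add: add_ac mult_ac)
  qed
  have unif: "uniform_limit {0..1} (\<lambda>N s. \<Sum>k<N. u k s) (\<lambda>s. \<Sum>k. u k s) sequentially"
  proof (rule Weierstrass_m_test)
    show "summable (\<lambda>k. \<bar>pochhammer (- \<alpha>) k / fact k\<bar> * w ^ k)"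
      using assms by (intro binomial_series_abs_summable) auto
    fix k and s :: real assume s: "s \<in> {0..1}"
    have "\<bar>s ^ (m + k) * (1 - s) ^ n\<bar> \<le> 1"
      using s by (auto simp: abs_mult power_abs intro!: mult_le_one power_le_one)
    then have "\<bar>pochhammer (- \<alpha>) k / fact k * w ^ k\<bar> * \<bar>s ^ (m + k) * (1 - s) ^ n\<bar>
        \<le> \<bar>pochhammer (- \<alpha>) k / fact k * w ^ k\<bar> * 1"
      by (intro mult_left_mono) auto
    then show "norm (u k s) \<le> \<bar>pochhammer (- \<alpha>) k / fact k\<bar> * w ^ k"
      using assms by (simp add: u_def abs_mult)
  qed
  have u_sum: "(\<Sum>k. u k s) = s ^ m * (1 - s) ^ n * (1 - w * s) powr \<alpha>" if "s \<in> {0..1}" for s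
  proof -
    have "w * s \<le> w * 1" using that assms by (intro mult_left_mono) auto
    then have "w * s < 1" using assms by linarith
    moreover have "0 \<le> w * s" using that assms by simp
    ultimately have "\<bar>w * s\<bar> < 1" by linarith
    from sums_mult[OF binomial_series_sums[OF this, of \<alpha>], of "s ^ m * (1 - s) ^ n"]
    have "(\<lambda>k. u k s) sums (s ^ m * (1 - s) ^ n * (1 - w * s) powr \<alpha>)"
      by (simp add: u_def power_mult_distrib power_add mult_ac)
    then show ?thesis by (simp add: sums_iff)
  qed
  have cont: "continuous_on {0..1} (\<lambda>s. \<Sum>k<N. u k s)" for N
    unfolding u_def by (intro continuous_intros)
  obtain I J where I: "\<And>N. ((\<lambda>s. \<Sum>k<N. u k s) has_integral I N) {0..1}"
    and J: "((\<lambda>s. \<Sum>k. u k s) has_integral J) {0..1}" and lim: "I \<longlonglongrightarrow> J"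
    using uniform_limit_integral[OF unif cont] by auto
  have "I N = (\<Sum>k<N. ?B * (hyp2F1_coeff \<alpha> m n k * w ^ k))" for N
    by (rule has_integral_unique[OF I], rule has_integral_sum) (auto intro: u_int)
  then have "I = (\<lambda>N. \<Sum>k<N. ?B * (hyp2F1_coeff \<alpha> m n k * w ^ k))" ..
  then have sumJ: "(\<lambda>k. ?B * (hyp2F1_coeff \<alpha> m n k * w ^ k)) sums J"
    using lim unfolding sums_def by simp
  have B: "?B > 0" by (simp add: Beta_nat_left pochhammer_pos)
  have "(\<lambda>k. hyp2F1_coeff \<alpha> m n k * w ^ k) sums (J / ?B)"
    using sums_divide[OF sumJ, of ?B] B by simp
  moreover have "((\<lambda>s. s ^ m * (1 - s) ^ n * (1 - w * s) powr \<alpha>) has_integral ?B * (J / ?B)) {0..1}"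
    using has_integral_eq[OF u_sum J] B by simp
  ultimately show ?thesis by blast
qed

lemma Euler_integral_lower:
  fixes \<alpha> w :: real
  assumes "0 < w" "w < 1" "\<alpha> > 0"
  shows "\<exists>S. (\<lambda>k. hyp2F1_coeff \<alpha> m n k * w ^ k) sums S \<and>
    ((\<lambda>t. t ^ m * (w - t) ^ n * (1 - t) powr \<alpha>) has_integral
       w ^ (n + m + 1) * (Beta (of_nat m + 1) (of_nat n + 1) * S)) {0..w}"
proof -
  from Euler_integral_unit_sums[OF assms] obtain S where
    S: "(\<lambda>k. hyp2F1_coeff \<alpha> m n k * w ^ k) sums S" and
    int: "((\<lambda>s. s ^ m * (1 - s) ^ n * (1 - w * s) powr \<alpha>) has_integral
       Beta (of_nat m + 1) (of_nat n + 1) * S) {0..1}" by blast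
  from has_integral_mult_right[OF int, of "w ^ (m + n)"]
  have "((\<lambda>s. (0 + (w - 0) * s) ^ m * (w - (0 + (w - 0) * s)) ^ n * (1 - (0 + (w - 0) * s)) powr \<alpha>)
      has_integral w ^ (m + n) * (Beta (of_nat m + 1) (of_nat n + 1) * S)) {0..1}"
  proof (rule has_integral_eq[rotated])
    fix s :: real
    have "(w - w * s) ^ n = w ^ n * (1 - s) ^ n"
      by (simp add: algebra_simps flip: power_mult_distrib)
    then show "w ^ (m + n) * (s ^ m * (1 - s) ^ n * (1 - w * s) powr \<alpha>) =
        (0 + (w - 0) * s) ^ m * (w - (0 + (w - 0) * s)) ^ n * (1 - (0 + (w - 0) * s)) powr \<alpha>"
      by (simp add: power_mult_distrib power_add)
  qed
  from has_integral_rescale_unit_interval[OF this assms(1)] S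
  show ?thesis by (auto simp: power_add mult_ac)
qed

section \<open>The finite side on the unit interval\<close>

text \<open>
  The two terminating series of the theorem in the variable \<open>w = inverse z\<close>, multiplied by
  \<open>w ^ (n + m + 1)\<close> and divided by the prefactor of the left-hand side. In this form each sum is a
  polynomial in \<open>w\<close>, so that the expression is visibly holomorphic at \<open>0\<close> as well.
\<close>
definition closed_form :: "real \<Rightarrow> nat \<Rightarrow> nat \<Rightarrow> complex \<Rightarrow> complex" where
  "closed_form \<alpha> m n w =
     pochhammer (of_nat n + 1) (m + 1) / pochhammer (of_nat n + of_real \<alpha> + 1) (m + 1) *
       (\<Sum>i\<le>n. pochhammer (- of_nat n) i * pochhammer (of_nat m + 1) i /
          (pochhammer (- of_nat n - of_real \<alpha>) i * fact i) * (w ^ (n - i) * (w - 1) ^ i)) -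
     (-1) ^ n * (1 - w) ^ (n + 1) * (1 - w) powr of_real \<alpha> *
       (pochhammer (of_nat m + 1) (n + 1) / pochhammer (of_nat m + of_real \<alpha> + 1) (n + 1) *
       (\<Sum>j\<le>m. pochhammer (- of_nat m) j * pochhammer (of_nat n + 1) j /
          (pochhammer (- of_nat m - of_real \<alpha>) j * fact j) * w ^ (m - j)))"

lemma series_eq_closed_form_real:
  fixes \<alpha> w :: real
  assumes "0 < w" "w < 1" "\<alpha> > 0"
  shows "of_real w ^ (n + m + 1) *
      hyp2F1_series (of_nat m + 1) (- of_real \<alpha>) (of_nat n + of_nat m + 2) (of_real w) =
    closed_form \<alpha> m n (of_real w)"
proof -
  let ?B = "Beta (of_nat m + 1) (of_nat n + 1) :: real"
  from Euler_integral_lower[OF assms] obtain S where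
    S: "(\<lambda>k. hyp2F1_coeff \<alpha> m n k * w ^ k) sums S" and
    low: "((\<lambda>t. t ^ m * (w - t) ^ n * (1 - t) powr \<alpha>) has_integral
       w ^ (n + m + 1) * (?B * S)) {0..w}" by blast
  define p where "p = pochhammer (of_nat n + 1) (m + 1) / pochhammer (of_nat n + \<alpha> + 1) (m + 1) *
       (\<Sum>i\<le>n. pochhammer (- of_nat n) i * pochhammer (of_nat m + 1) i /
          (pochhammer (- of_nat n - \<alpha>) i * fact i) * (w ^ (n - i) * (w - 1) ^ i))"
  define q where "q = pochhammer (of_nat m + 1) (n + 1) / pochhammer (of_nat m + \<alpha> + 1) (n + 1) *
       (\<Sum>j\<le>m. pochhammer (- of_nat m) j * pochhammer (of_nat n + 1) j /
          (pochhammer (- of_nat m - \<alpha>) j * fact j) * w ^ (m - j))"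
  have p: "(\<Sum>i\<le>n. of_nat (n choose i) * Beta (of_nat (m + i) + 1) (of_nat (n - i) + \<alpha> + 1) *
         (w ^ (n - i) * (w - 1) ^ i)) = ?B * p"
    unfolding p_def sum_distrib_left
    by (intro sum.cong refl) (simp only: binomial_times_Beta[OF assms(3)] atMost_iff mult.assoc)
  have q: "(\<Sum>j\<le>m. of_nat (m choose j) * Beta (of_nat (n + j) + 1) (of_nat (m - j) + \<alpha> + 1) *
         w ^ (m - j)) = ?B * q"
    unfolding q_def sum_distrib_left
    by (intro sum.cong refl)
      (simp only: binomial_times_Beta[OF assms(3)] atMost_iff mult.assoc Beta_commute[of "of_nat n + 1"])
  have "w ^ (n + m + 1) * (?B * S) + (-1) ^ n * (1 - w) ^ (n + 1) * (1 - w) powr \<alpha> * (?B * q) = ?B * p"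
    using has_integral_combine[OF _ _ low Euler_integral_upper[OF assms(3,2), of m n, unfolded q]] assms
      Euler_integral_whole[OF assms(3), of m w n, unfolded p]
    by (auto intro: has_integral_unique)
  then have "?B * (w ^ (n + m + 1) * S) = ?B * (p - (-1) ^ n * (1 - w) ^ (n + 1) * (1 - w) powr \<alpha> * q)"
    by (simp add: algebra_simps)
  moreover have "?B > 0" by (simp add: Beta_nat_left pochhammer_pos)
  ultimately have eq: "w ^ (n + m + 1) * S = p - (-1) ^ n * (1 - w) ^ (n + 1) * (1 - w) powr \<alpha> * q"
    by (metis less_irrefl mult_left_cancel)
  have "(\<lambda>k. complex_of_real (hyp2F1_coeff \<alpha> m n k * w ^ k)) sums of_real S"
    using S by (simp only: sums_of_real_iff)
  moreover have "complex_of_real (hyp2F1_coeff \<alpha> m n k * w ^ k) =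
      pochhammer (of_nat m + 1) k * pochhammer (- of_real \<alpha>) k /
      (pochhammer (of_nat n + of_nat m + 2) k * fact k) * of_real w ^ k" for k
    by (simp add: hyp2F1_coeff_def flip: pochhammer_of_real)
  ultimately have ser: "hyp2F1_series (of_nat m + 1) (- of_real \<alpha>) (of_nat n + of_nat m + 2) (of_real w)
      = of_real S"
    by (simp add: hyp2F1_series_def sums_iff)
  have "closed_form \<alpha> m n (of_real w) =
      of_real (p - (-1) ^ n * (1 - w) ^ (n + 1) * (1 - w) powr \<alpha> * q)"
    using assms unfolding closed_form_def p_def q_def
    by (simp add: powr_of_real[symmetric] flip: pochhammer_of_real)
  then show ?thesis by (simp only: ser flip: eq of_real_power of_real_mult)
qed

section \<open>Analytic continuation to the slit plane\<close>

text \<open>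
  As \<open>(m + 1)\<^sub>k \<le> (n + m + 2)\<^sub>k\<close>, the coefficients are dominated by those of the binomial series.
\<close>
lemma hyp2F1_series_holomorphic:
  fixes \<alpha> :: real
  shows "hyp2F1_series (of_nat m + 1) (- of_real \<alpha>) (of_nat n + of_nat m + 2) holomorphic_on ball 0 1"
proof (rule power_series_holomorphic)
  fix w :: complex assume w: "w \<in> ball 0 1"
  define c :: "nat \<Rightarrow> complex" where
    "c k = pochhammer (of_nat m + 1) k * pochhammer (- of_real \<alpha>) k /
      (pochhammer (of_nat n + of_nat m + 2) k * fact k)" for k
  have c: "c k = complex_of_real (hyp2F1_coeff \<alpha> m n k)" for k
    by (simp add: c_def hyp2F1_coeff_def flip: pochhammer_of_real)
  have "summable (\<lambda>k. c k * w ^ k)"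
  proof (rule summable_comparison_test'[where N = 0])
    show "summable (\<lambda>k. \<bar>pochhammer (- \<alpha>) k / fact k\<bar> * norm w ^ k)"
      using w by (intro binomial_series_abs_summable) auto
    fix k :: nat
    have pos: "pochhammer (of_nat n + of_nat m + 2 :: real) k > 0" "pochhammer (real m + 1) k \<ge> 0"
      by (auto intro!: pochhammer_pos pochhammer_nonneg)
    have "pochhammer (real m + 1) k \<le> pochhammer (of_nat n + of_nat m + 2) k"
      unfolding pochhammer_prod by (intro prod_mono) auto
    then have "pochhammer (real m + 1) k / pochhammer (of_nat n + of_nat m + 2) k \<le> 1"
      using pos by simp
    then have "pochhammer (real m + 1) k / pochhammer (of_nat n + of_nat m + 2) k *
        \<bar>pochhammer (- \<alpha>) k / fact k\<bar> \<le> 1 * \<bar>pochhammer (- \<alpha>) k / fact k\<bar>"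
      by (intro mult_right_mono) auto
    then have "\<bar>hyp2F1_coeff \<alpha> m n k\<bar> \<le> \<bar>pochhammer (- \<alpha>) k / fact k\<bar>"
      using pos by (simp add: hyp2F1_coeff_def abs_mult)
    then show "norm (c k * w ^ k) \<le> \<bar>pochhammer (- \<alpha>) k / fact k\<bar> * norm w ^ k"
      unfolding c norm_mult norm_power norm_of_real by (intro mult_right_mono) auto
  qed
  then show "(\<lambda>k. c k * (w - 0) ^ k) sums
      hyp2F1_series (of_nat m + 1) (- of_real \<alpha>) (of_nat n + of_nat m + 2) w"
    by (simp add: hyp2F1_series_def c_def summable_sums)
qed

lemma one_minus_not_nonpos: "1 - w \<notin> \<real>\<^sub>\<le>\<^sub>0" if "w \<in> slit_plane"
proof
  assume "1 - w \<in> \<real>\<^sub>\<le>\<^sub>0"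
  then obtain r where r: "r \<le> 0" "1 - w = of_real r" by (auto elim!: nonpos_Reals_cases)
  then have "w = of_real (1 - r)" by (simp add: algebra_simps)
  then have "w \<in> complex_of_real ` {1..}" by (rule image_eqI) (use r in auto)
  then show False using that by (simp add: slit_plane_def)
qed

lemma closed_form_holomorphic: "closed_form \<alpha> m n holomorphic_on slit_plane"
  unfolding closed_form_def using one_minus_not_nonpos
  by (auto intro!: holomorphic_intros)

text \<open>
  Identity theorem in the unit disc: the points of \<open>(0, 1)\<close>, where the integrals apply, accumulate
  at \<open>0\<close>.
\<close>
lemma series_eq_closed_form:
  fixes \<alpha> :: real
  assumes "\<alpha> > 0" "norm w < 1"
  shows "w ^ (n + m + 1) *
      hyp2F1_series (of_nat m + 1) (- of_real \<alpha>) (of_nat n + of_nat m + 2) w = closed_form \<alpha> m n w"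
proof -
  let ?d = "\<lambda>w. w ^ (n + m + 1) *
      hyp2F1_series (of_nat m + 1) (- of_real \<alpha>) (of_nat n + of_nat m + 2) w - closed_form \<alpha> m n w"
  have "?d w = 0"
  proof (rule analytic_continuation[where f = ?d and S = "ball 0 1" and U = "of_real ` {0<..<1}" and \<xi> = 0])
    show "?d holomorphic_on ball 0 1"
      using hyp2F1_series_holomorphic
        holomorphic_on_subset[OF closed_form_holomorphic ball_subset_slit_plane]
      by (intro holomorphic_intros) auto
    show "0 islimpt complex_of_real ` {0<..<1}"
      unfolding islimpt_approachable
    proof (intro allI impI)
      fix e :: real assume "e > 0"
      then show "\<exists>x'\<in>complex_of_real ` {0<..<1}. x' \<noteq> 0 \<and> dist x' 0 < e"
        by (intro bexI[of _ "of_real (min e 1 / 2)"] imageI) (auto simp: min_def)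
    qed
    show "?d x = 0" if "x \<in> of_real ` {0<..<1}" for x
      using that series_eq_closed_form_real[OF _ _ assms(1)] by auto
  qed (use assms in auto)
  then show ?thesis by simp
qed

text \<open>
  The quotient is holomorphic on the slit plane except at \<open>0\<close>, where it agrees with the power
  series on a punctured neighbourhood. Gluing the two gives the analytic continuation, whose
  existence is thus a consequence of the finite formula.
\<close>
lemma hyp2F1_eq_closed_form:
  fixes \<alpha> :: real
  assumes "\<alpha> > 0" "w \<in> slit_plane" "w \<noteq> 0"
  shows "hyp2F1 (of_nat m + 1) (- of_real \<alpha>) (of_nat n + of_nat m + 2) w =
    closed_form \<alpha> m n w / w ^ (n + m + 1)"
proof -
  let ?F = "hyp2F1_series (of_nat m + 1) (- of_real \<alpha>) (of_nat n + of_nat m + 2)"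
  let ?R = "\<lambda>w. closed_form \<alpha> m n w / w ^ (n + m + 1)"
  define g where "g w = (if norm w < 1 then ?F w else ?R w)" for w
  have FR: "?F w = ?R w" if "norm w < 1" "w \<noteq> 0" for w
    using series_eq_closed_form[OF assms(1) that(1), of n m] that by (simp add: field_simps)
  have "g holomorphic_on ball 0 1 \<union> (slit_plane - {0})"
  proof (rule holomorphic_on_Un)
    show "g holomorphic_on ball 0 1"
      by (rule holomorphic_transform[OF hyp2F1_series_holomorphic]) (auto simp: g_def)
    have "?R holomorphic_on slit_plane - {0}"
      by (intro holomorphic_intros holomorphic_on_subset[OF closed_form_holomorphic]) auto
    then show "g holomorphic_on slit_plane - {0}"
      by (rule holomorphic_transform) (auto simp: g_def FR)
  qed (auto intro: open_slit_plane)
  moreover have "ball 0 1 \<union> (slit_plane - {0}) = slit_plane"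
    using ball_subset_slit_plane by auto
  ultimately have "hyp2F1_continuation (of_nat m + 1) (- of_real \<alpha>) (of_nat n + of_nat m + 2) g"
    by (simp add: hyp2F1_continuation_def g_def)
  then have "hyp2F1 (of_nat m + 1) (- of_real \<alpha>) (of_nat n + of_nat m + 2) w = g w"
    using assms(2) by (rule hyp2F1_eq_continuation)
  then show ?thesis using FR assms(3) by (simp add: g_def)
qed

section \<open>Back to the variable z\<close>

text \<open>
  The factor \<open>z ^ (n + m + 1)\<close> distributes as \<open>z ^ n\<close> and \<open>z ^ m\<close> into the two sums, where
  \<open>z * (w - 1) = 1 - z\<close> and \<open>z * w = 1\<close> for \<open>w = inverse z\<close>. What is left over is \<open>z ^ (m + 1)\<close> in the
  first term; in the second, \<open>z ^ (n + 1)\<close> turns \<open>(1 - w) ^ (n + 1)\<close> into \<open>(1 - z) ^ (n + 1)\<close> up to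
  the sign \<open>(-1) ^ (n + 1)\<close>, which makes the difference a sum.
\<close>
lemma closed_form_inverse:
  assumes "z \<noteq> 0"
  shows "z ^ (n + m + 1) * closed_form \<alpha> m n (inverse z) =
    pochhammer (of_nat n + 1) (m + 1) / pochhammer (of_nat n + of_real \<alpha> + 1) (m + 1) *
      z ^ (m + 1) * hyp2F1_term n (of_nat m + 1) (- of_nat n - of_real \<alpha>) (1 - z) +
    (1 - z) ^ (n + 1) * (1 - inverse z) powr of_real \<alpha> *
      (pochhammer (of_nat m + 1) (n + 1) / pochhammer (of_nat m + of_real \<alpha> + 1) (n + 1) *
      hyp2F1_term m (of_nat n + 1) (- of_nat m - of_real \<alpha>) z)"
proof -
  let ?w = "inverse z"
  have P: "z ^ n * (\<Sum>i\<le>n. a i * (?w ^ (n - i) * (?w - 1) ^ i)) = (\<Sum>i\<le>n. a i * (1 - z) ^ i)"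
    for a :: "nat \<Rightarrow> complex"
    unfolding sum_distrib_left
  proof (intro sum.cong refl)
    fix i assume "i \<in> {..n}"
    then have "z ^ n = z ^ (n - i) * z ^ i" by (simp flip: power_add)
    then have "z ^ n * (?w ^ (n - i) * (?w - 1) ^ i) = (z * ?w) ^ (n - i) * (z * (?w - 1)) ^ i"
      by (simp only: power_mult_distrib mult_ac)
    also have "\<dots> = (1 - z) ^ i" using assms by (simp add: right_diff_distrib)
    finally show "z ^ n * (a i * (?w ^ (n - i) * (?w - 1) ^ i)) = a i * (1 - z) ^ i"
      by (simp add: mult.left_commute)
  qed
  have Q: "z ^ m * (\<Sum>j\<le>m. b j * ?w ^ (m - j)) = (\<Sum>j\<le>m. b j * z ^ j)"
    for b :: "nat \<Rightarrow> complex"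
    unfolding sum_distrib_left
  proof (intro sum.cong refl)
    fix j assume "j \<in> {..m}"
    then have "z ^ m = z ^ (m - j) * z ^ j" by (simp flip: power_add)
    then have "z ^ m * ?w ^ (m - j) = (z * ?w) ^ (m - j) * z ^ j"
      by (simp only: power_mult_distrib mult_ac)
    then show "z ^ m * (b j * ?w ^ (m - j)) = b j * z ^ j"
      using assms by (simp add: mult.left_commute)
  qed
  have "z ^ (n + 1) * ((-1) ^ n * (1 - ?w) ^ (n + 1)) = - ((- 1 * z * (1 - ?w)) ^ (n + 1))"
    unfolding power_mult_distrib by simp
  also have "- 1 * z * (1 - ?w) = 1 - z" using assms by (simp add: algebra_simps)
  finally have K: "z ^ (n + 1) * ((-1) ^ n * (1 - ?w) ^ (n + 1)) = - ((1 - z) ^ (n + 1))" .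
  have "z ^ (n + m + 1) * (A * X - (-1) ^ n * (1 - ?w) ^ (n + 1) * U * (B * Y)) =
      A * z ^ (m + 1) * (z ^ n * X) + (1 - z) ^ (n + 1) * U * (B * (z ^ m * Y))" for A B X Y U
  proof -
    have "z ^ (n + m + 1) * (A * X - (-1) ^ n * (1 - ?w) ^ (n + 1) * U * (B * Y)) =
        A * z ^ (m + 1) * (z ^ n * X) -
        (z ^ (n + 1) * ((-1) ^ n * (1 - ?w) ^ (n + 1))) * U * (B * (z ^ m * Y))"
      by (simp only: power_add right_diff_distrib mult_ac)
    then show ?thesis unfolding K by simp
  qed
  then show ?thesis
    unfolding closed_form_def hyp2F1_term_def by (simp only: P Q)
qed

theorem mainTheorem1:
  fixes \<alpha> :: real and n m :: nat and z :: complex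
  assumes "\<alpha> > 0" and "z \<notin> complex_of_real ` {0..1}"
  shows
    "(1 - z) powi (- int n - 1) * (1 - inverse z) powr (- of_real \<alpha>)
        * hyp2F1 (of_nat m + 1) (- of_real \<alpha>) (of_nat n + of_nat m + 2) (inverse z)
     = pochhammer (of_nat n + 1) (m + 1) / pochhammer (of_nat n + of_real \<alpha> + 1) (m + 1)
         * z ^ (m + 1) * (1 - z) powi (- int n - 1) * (1 - inverse z) powr (- of_real \<alpha>)
         * hyp2F1_term n (of_nat m + 1) (- of_nat n - of_real \<alpha>) (1 - z)
       + pochhammer (of_nat m + 1) (n + 1) / pochhammer (of_nat m + of_real \<alpha> + 1) (n + 1)
         * hyp2F1_term m (of_nat n + 1) (- of_nat m - of_real \<alpha>) z"
proof -
  have z0: "z \<noteq> 0" and z1: "z \<noteq> 1"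
    using assms(2) by (metis atLeastAtMost_iff image_eqI of_real_0 of_real_1 order_refl zero_le_one)+
  have w: "inverse z \<in> slit_plane"
  proof (rule ccontr)
    assume "inverse z \<notin> slit_plane"
    then obtain r where r: "r \<ge> 1" "inverse z = of_real r" by (auto simp: slit_plane_def)
    then have "z = of_real (inverse r)" by (metis inverse_inverse_eq of_real_inverse)
    moreover have "inverse r \<in> {0..1}" using r by (auto simp: inverse_le_1_iff)
    ultimately show False using assms(2) by blast
  qed
  define U where "U = (1 - inverse z) powr of_real \<alpha>"
  define D where "D = (1 - z) ^ (n + 1)"
  have "U \<noteq> 0" "D \<noteq> 0" using z0 z1 by (auto simp: U_def D_def)
  have U: "(1 - inverse z) powr (- of_real \<alpha>) = inverse U"
    by (simp add: U_def powr_minus)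
  have "- int n - 1 = - int (n + 1)" by simp
  then have D: "(1 - z) powi (- int n - 1) = inverse D"
    unfolding D_def by (simp only: power_int_minus power_int_of_nat)
  have F: "hyp2F1 (of_nat m + 1) (- of_real \<alpha>) (of_nat n + of_nat m + 2) (inverse z) =
      z ^ (n + m + 1) * closed_form \<alpha> m n (inverse z)"
    using hyp2F1_eq_closed_form[OF assms(1) w, of m n] z0
    by (simp add: power_inverse divide_inverse)
  have "inverse D * inverse U * (A * x * P + D * U * (B * Q)) =
      A * x * inverse D * inverse U * P + B * Q" for A x P B Q
    using \<open>U \<noteq> 0\<close> \<open>D \<noteq> 0\<close> by (simp add: field_simps)
  then show ?thesis
    unfolding F closed_form_inverse[OF z0] U D U_def[symmetric] D_def[symmetric] .
qed

end
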